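(* Let $\{q_k\}_{k\in\mathbb{N}}$ be a sequence of real numbers with $1\le q_k<\infty$ for all $k$. Then $\ell^{q_k}=\ell^1$ (equality as sets of sequences) if and only if there exists a natural number $N>1$ such that $$\sum_k N^{-\frac{1}{q_k-1}}<\infty,$$ with the convention that $N^{-\frac{1}{q_k-1}}=N^{-\infty}=0$ whenever $q_k=1$.
   Context: For a sequence $\{q_k\}_{k\in\mathbb{N}}$ of positive real numbers, $\ell^{q_k}$ denotes the set of (real or complex) sequences $x=\{x_k\}_{k\in\mathbb{N}}$ with $\sum_k |x_k|^{q_k}<\infty$ (the exponent varies with the index $k$). $\ell^1$ is the usual space of absolutely summable sequences. *)

theory Defs
  imports Complex_Main
begin

text \<open>
  Real or complex sequences are treated uniformly through the class real_normed_field: its norm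
  is multiplicative, so up to isomorphism its only instances are the reals and the complex numbers.
\<close>

text \<open>
  Only meant for positive exponents, for which \<open>0 powr q k = 0\<close> agrees with the usual power.
\<close>
definition ell_var :: "(nat \<Rightarrow> real) \<Rightarrow> (nat \<Rightarrow> 'a::real_normed_field) set" where
  "ell_var q = {x. summable (\<lambda>k. norm (x k) powr q k)}"

definition ell1 :: "(nat \<Rightarrow> 'a::real_normed_field) set" where
  "ell1 = {x. summable (\<lambda>k. norm (x k))}"

text \<open>
  The value of \<open>N\<close> to the power \<open>- 1 / (q - 1)\<close>.  The case \<open>q = 1\<close> must be singled out: it stands
  for \<open>N\<close> to the power \<open>-\<infinity>\<close>, that is \<open>0\<close>, whereas \<open>1 / 0 = 0\<close> in HOL would make it \<open>1\<close>.
\<close>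
definition conj_term :: "nat \<Rightarrow> real \<Rightarrow> real" where
  "conj_term N q = (if q = 1 then 0 else real N powr (- (1 / (q - 1))))"

end

theory Submission
  imports Defs
begin

text \<open>
  Put \<open>c N k = N powr (- 1 / (q k - 1))\<close>, so that \<open>c N k powr q k = c N k / N\<close>.  If \<open>\<Sum>k. c N k\<close>
  converges, then \<open>a \<le> N * a powr q k + c N k\<close> for all \<open>a \<ge> 0\<close> gives the nontrivial inclusion.
  If it diverges for every \<open>N\<close>, choose \<open>x k = c (N k) k\<close> greedily, with \<open>N k\<close> about the square of
  the partial sum \<open>S k\<close> of the earlier \<open>x i\<close>.  Then \<open>\<Sum>k. x k\<close> diverges, since otherwise \<open>N k\<close> would
  stay bounded, whereas \<open>\<Sum>k. x k powr q k = \<Sum>k. x k / N k\<close> is dominated by the telescoping series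
  \<open>\<Sum>k. 1 / (S k + 1) - 1 / (S (Suc k) + 1)\<close>.
\<close>

lemma conj_term_nonneg: "0 \<le> conj_term N q"
  by (simp add: conj_term_def)

lemma conj_term_le_1:
  assumes "1 \<le> q" "1 \<le> N"
  shows "conj_term N q \<le> 1"
  using assms powr_mono[of "- (1 / (q - 1))" 0 "real N"] by (auto simp: conj_term_def)

lemma conj_term_antimono:
  assumes "1 \<le> q" "1 \<le> M" "M \<le> N"
  shows "conj_term N q \<le> conj_term M q"
  using assms by (auto simp: conj_term_def intro!: powr_mono2')

text \<open>For \<open>q > 1\<close> the exponents satisfy
  \<open>- q / (q - 1) = - 1 / (q - 1) - 1\<close>; for \<open>q = 1\<close> both sides
  vanish.\<close>

lemma conj_term_powr:
  assumes "1 \<le> q" "1 \<le> N"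
  shows "conj_term N q powr q = conj_term N q / real N"
proof (cases "q = 1")
  case False
  then have "- (1 / (q - 1)) * q = - (1 / (q - 1)) - 1"
    using assms by (simp add: field_simps)
  then have "conj_term N q powr q = real N powr (- (1 / (q - 1)) - 1)"
    using False by (simp add: conj_term_def powr_powr)
  also have "\<dots> = conj_term N q / real N"
    using False assms by (simp add: conj_term_def powr_diff)
  finally show ?thesis .
qed (simp add: conj_term_def)

text \<open>A crude form of Young's inequality: one of the two summands alone dominates
  \<open>a\<close>. If \<open>a\<close> exceeds \<open>conj_term N q\<close> and
  \<open>q > 1\<close>, then \<open>a powr (q - 1)\<close> is at least \<open>1 / N\<close>, because
  the exponents \<open>- 1 / (q - 1)\<close> and \<open>q - 1\<close> multiply to
  \<open>- 1\<close>.\<close>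

lemma le_mult_powr_plus_conj_term:
  assumes "1 \<le> q" "1 \<le> N" "0 \<le> a"
  shows "a \<le> real N * a powr q + conj_term N q"
proof (cases "a \<le> conj_term N q")
  case True
  then show ?thesis by (simp add: add_increasing)
next
  case False
  then have a: "0 < a" "conj_term N q < a"
    using conj_term_nonneg[of N q] by auto
  have "1 \<le> real N * a powr (q - 1)"
  \<comment> \<open>For \<open>q = 1\<close> the claim is \<open>1 \<le> N\<close>, since
    \<open>a powr 0 = 1\<close> for \<open>a > 0\<close>.\<close>
  proof (cases "q = 1")
    case True
    then show ?thesis using assms a by simp
  next
    case q: False
    have "1 / real N = (real N powr (- (1 / (q - 1)))) powr (q - 1)"
      using q assms by (simp only: powr_powr) (simp add: powr_minus_divide)
    also have "\<dots> \<le> a powr (q - 1)"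
      using q assms a by (intro powr_mono2) (auto simp: conj_term_def)
    finally show ?thesis using assms by (simp add: field_simps)
  qed
  then have "a * 1 \<le> a * (real N * a powr (q - 1))"
    using a by (intro mult_left_mono) auto
  also have "\<dots> = real N * a powr q"
    using a by (simp add: powr_diff)
  finally show ?thesis using conj_term_nonneg[of N q] by simp
qed

text \<open>The terms of a summable sequence are eventually below 1 in norm, and there an exponent
  at least 1 only makes them smaller.\<close>

lemma ell1_subset_ell_var:
  assumes "\<And>k. 1 \<le> q k"
  shows "ell1 \<subseteq> ell_var q"
proof
  fix x :: "nat \<Rightarrow> 'a"
  assume "x \<in> ell1"
  then have x: "summable (\<lambda>k. norm (x k))" by (simp add: ell1_def)
  then have "\<forall>\<^sub>F k in sequentially. norm (x k) < 1"
    by (intro order_tendstoD(2)[OF summable_LIMSEQ_zero]) auto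
  then have "\<forall>\<^sub>F k in sequentially. norm (norm (x k) powr q k) \<le> norm (x k)"
  proof eventually_elim
    case (elim k)
    then show ?case
      using powr_mono'[of 1 "q k" "norm (x k)"] assms[of k] by simp
  qed
  then show "x \<in> ell_var q"
    using x unfolding ell_var_def by (auto intro: summable_comparison_test_ev)
qed

lemma ell_var_subset_ell1:
  assumes "\<And>k. 1 \<le> q k" "1 \<le> N" "summable (\<lambda>k. conj_term N (q k))"
  shows "ell_var q \<subseteq> ell1"
proof
  fix x :: "nat \<Rightarrow> 'a"
  assume "x \<in> ell_var q"
  then have "summable (\<lambda>k. real N * norm (x k) powr q k + conj_term N (q k))"
    using assms(3) by (intro summable_add summable_mult) (auto simp: ell_var_def)
  then show "x \<in> ell1"
    unfolding ell1_def
    using le_mult_powr_plus_conj_term[OF assms(1,2)] by (auto intro: summable_comparison_test')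
qed

text \<open>The summand 2 keeps the value above 1 for every real \<open>s\<close>, and leaves room
  for replacing \<open>S (Suc k) + 1\<close> by \<open>S k + 2\<close> in the telescoping
  estimate.\<close>

definition square_bound :: "real \<Rightarrow> nat" where
  "square_bound s = (nat \<lceil>s\<rceil> + 2)\<^sup>2"

lemma square_bound_gt_1: "1 < square_bound s"
  by (simp add: square_bound_def power2_eq_square)

lemma square_bound_mono: "s \<le> t \<Longrightarrow> square_bound s \<le> square_bound t"
  unfolding square_bound_def by (intro power_mono add_right_mono nat_mono ceiling_mono) auto

lemma square_le_square_bound:
  assumes "0 \<le> s"
  shows "(s + 2)\<^sup>2 \<le> real (square_bound s)"
proof -
  have "s + 2 \<le> real (nat \<lceil>s\<rceil> + 2)" by linarith
  from power_mono[OF this, of 2] assms show ?thesis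
    unfolding square_bound_def of_nat_power by linarith
qed

text \<open>The recursion runs on the partial sums, as each new term depends on the earlier ones
  only through their sum.\<close>

primrec greedy_sum :: "(nat \<Rightarrow> real) \<Rightarrow> nat \<Rightarrow> real" where
  "greedy_sum q 0 = 0"
| "greedy_sum q (Suc k) = greedy_sum q k + conj_term (square_bound (greedy_sum q k)) (q k)"

lemma greedy_sum_nonneg: "0 \<le> greedy_sum q k"
  by (induction k) (auto simp: conj_term_nonneg)

lemma ex_summable_powr_not_summable:
  assumes q: "\<And>k. 1 \<le> q k"
    and div: "\<And>N. 1 < N \<Longrightarrow> \<not> summable (\<lambda>k. conj_term N (q k))"
  shows "\<exists>x :: nat \<Rightarrow> real. (\<forall>k. 0 \<le> x k) \<and> summable (\<lambda>k. x k powr q k) \<and> \<not> summable x"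
proof -
  define S where "S = greedy_sum q"
  define N where "N k = square_bound (S k)" for k
  define x where "x k = conj_term (N k) (q k)" for k
  have S: "S 0 = 0" "S (Suc k) = S k + x k" "0 \<le> S k" for k
    by (simp_all add: S_def N_def x_def greedy_sum_nonneg)
  have N: "1 < N k" "(S k + 2)\<^sup>2 \<le> real (N k)" for k
    unfolding N_def by (rule square_bound_gt_1, rule square_le_square_bound[OF S(3)])
  have x: "0 \<le> x k" "x k \<le> 1" for k
    using conj_term_le_1[OF q, of "N k" k] N(1)[of k] by (auto simp: x_def conj_term_nonneg)
  have S_eq: "S k = sum x {..<k}" for k
    by (induction k) (simp_all add: S)
  have "\<not> summable x"
  proof
    assume "summable x"
    then have "N k \<le> square_bound (suminf x)" for k
      unfolding N_def S_eq using x(1) by (intro square_bound_mono sum_le_suminf) auto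
    \<comment> \<open>A bound on all \<open>N k\<close> yields one fixed base whose series is
      dominated by \<open>x\<close>, against \<open>div\<close>.\<close>
    then have "conj_term (square_bound (suminf x)) (q k) \<le> x k" for k
      unfolding x_def using N(1)[of k] by (intro conj_term_antimono q) auto
    then have "summable (\<lambda>k. conj_term (square_bound (suminf x)) (q k))"
      using \<open>summable x\<close> conj_term_nonneg by (auto intro: summable_comparison_test')
    then show False using div square_bound_gt_1 by blast
  qed
  moreover have "summable (\<lambda>k. x k powr q k)"
  proof (rule summableI_nonneg_bounded)
    fix n
    have "x k powr q k \<le> 1 / (S k + 1) - 1 / (S (Suc k) + 1)" for k
    proof -
      have pos: "0 < S k + 1" "0 < S (Suc k) + 1"
        using S(3)[of k] S(3)[of "Suc k"] by linarith+
      \<comment> \<open>Since \<open>x k \<le> 1\<close>, a single step raises the partial sum by at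
        most 1.\<close>
      have "(S k + 1) * (S (Suc k) + 1) \<le> (S k + 2) * (S k + 2)"
        using S(3)[of k] S(2)[of k] x[of k] by (intro mult_mono) linarith+
      then have le: "(S k + 1) * (S (Suc k) + 1) \<le> real (N k)"
        using N(2)[of k] unfolding power2_eq_square by linarith
      have "x k powr q k = x k / real (N k)"
        using conj_term_powr[OF q, of "N k" k] N(1)[of k] by (simp add: x_def)
      also have "\<dots> \<le> x k / ((S k + 1) * (S (Suc k) + 1))"
        using N(1)[of k] by (intro divide_left_mono[OF le x(1)] mult_pos_pos pos) simp
      \<comment> \<open>The numerator \<open>x k\<close> is the difference of the two
        denominators.\<close>
      also have "\<dots> = 1 / (S k + 1) - 1 / (S (Suc k) + 1)"
        using pos by (simp add: diff_frac_eq S(2))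
      finally show ?thesis .
    qed
    then have "(\<Sum>k<n. x k powr q k) \<le> (\<Sum>k<n. 1 / (S k + 1) - 1 / (S (Suc k) + 1))"
      by (intro sum_mono)
    also have "\<dots> = 1 / (S 0 + 1) - 1 / (S n + 1)"
      by (rule sum_lessThan_telescope')
    also have "\<dots> \<le> 1" using S(1) S(3)[of n] by simp
    finally show "(\<Sum>k<n. x k powr q k) \<le> 1" .
  qed simp
  ultimately show ?thesis using x(1) by blast
qed

theorem theorem3p3:
  fixes q :: "nat \<Rightarrow> real"
  assumes "\<And>k. 1 \<le> q k"
  shows "(ell_var q :: (nat \<Rightarrow> 'a::real_normed_field) set) = ell1
    \<longleftrightarrow> (\<exists>N::nat. N > 1 \<and> summable (\<lambda>k. conj_term N (q k)))"
proof
  assume eq: "(ell_var q :: (nat \<Rightarrow> 'a) set) = ell1"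
  show "\<exists>N::nat. N > 1 \<and> summable (\<lambda>k. conj_term N (q k))"
  proof (rule ccontr)
    assume "\<nexists>N. N > 1 \<and> summable (\<lambda>k. conj_term N (q k))"
    then have "\<not> summable (\<lambda>k. conj_term N (q k))" if "1 < N" for N
      using that by simp
    then obtain x where "\<forall>k. 0 \<le> x k" "summable (\<lambda>k. x k powr q k)" "\<not> summable x"
      using ex_summable_powr_not_summable[of q] assms by auto
    \<comment> \<open>The real counterexample embeds into \<open>'a\<close> with
      \<open>norm (of_real (x k)) = x k\<close>, as \<open>x k\<close> is nonnegative.\<close>
    then have "(\<lambda>k. of_real (x k) :: 'a) \<in> ell_var q - ell1"
      by (simp add: ell_var_def ell1_def)
    with eq show False by blast
  qed
next
  assume "\<exists>N::nat. N > 1 \<and> summable (\<lambda>k. conj_term N (q k))"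
  then obtain N where "1 \<le> N" "summable (\<lambda>k. conj_term N (q k))"
    using less_imp_le by blast
  then show "(ell_var q :: (nat \<Rightarrow> 'a) set) = ell1"
    using assms by (intro equalityI ell_var_subset_ell1 ell1_subset_ell_var)
qed

end
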